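(* Let $m,n\ge1$ be integers with $\max(m,n)>1$, let $q>0$, $a>0$, $b,c,d\ge 0$. Consider the directed grid $G_{m,n}$ with source $s=(0,0)$, sink $t=(m,n)$, total demand $q$, latency $ax+b$ on every grid edge, and an added chord $u\to v$ with latency $cx+d$. Then the Braess Ratio satisfies \[ BR\ \le\ 1+\frac{1}{\frac{m+n}{\max(m,n)-1}+2\sqrt{\frac{m+n}{\max(m,n)-1}}}\ <\ \frac43 . \]
   Context: Grid: $G_{m,n}=(V,E)$ is the directed graph with vertex set $V=\{0,\dots,m\}\times\{0,\dots,n\}$ and directed edges $(i,j)\to(i+1,j)$ for $i<m$ and $(i,j)\to(i,j+1)$ for $j<n$. Chord: an added directed edge $u\to v$ with $u,v\in V$, $u\ne v$, such that $uv$ is not an edge of the underlying undirected grid. Feasible flow (in the grid, or in the grid plus chord): a nonnegative number $f_e$ for each directed edge $e$, with flow conserved at every vertex other than $s,t$, and net outflow from $s$ and net inflow to $t$ both equal to $q$. Its cost is $C(f)=\sum_e f_e\ell_e(f_e)$, where $\ell_e$ is the latency function of $e$. User Equilibrium: a feasible flow, decomposable into flows along $s$-$t$ paths, such that every path carrying positive flow has latency (sum of $\ell_e(f_e)$ over its edges) no larger than that of any other $s$-$t$ path. By a classical theorem (Beckmann, McGuire, Winsten) these are exactly the minimizers over feasible flows of the Beckmann potential $Z(f)=\sum_e\int_0^{f_e}\ell_e(y)\,dy$; in the networks considered here the minimizer is unique. Braess Ratio: $BR=C_{\mathrm{new}}/C_{\mathrm{old}}$, where $C_{\mathrm{old}}$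 is the cost of the User Equilibrium of $G_{m,n}$ and $C_{\mathrm{new}}$ is the cost of the User Equilibrium of $G_{m,n}$ with the chord added (same $s,t,q$). *)

theory Defs
  imports Complex_Main "Graph_Theory.Graph_Theory"
begin

text \<open>
  Flows are functions on arcs and only their values on the arcs of the digraph matter.
  A latency assignment gives every arc a function of the flow on that arc.
\<close>

definition net_outflow :: "('v,'e) pre_digraph \<Rightarrow> ('e \<Rightarrow> real) \<Rightarrow> 'v \<Rightarrow> real" where
  "net_outflow G f w = (\<Sum>e\<in>out_arcs G w. f e) - (\<Sum>e\<in>in_arcs G w. f e)"

definition feasible_flow ::
  "('v,'e) pre_digraph \<Rightarrow> 'v \<Rightarrow> 'v \<Rightarrow> real \<Rightarrow> ('e \<Rightarrow> real) \<Rightarrow> bool" where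
  "feasible_flow G s t q f \<longleftrightarrow>
     (\<forall>e\<in>arcs G. 0 \<le> f e) \<and>
     (\<forall>w\<in>verts G - {s, t}. net_outflow G f w = 0) \<and>
     net_outflow G f s = q \<and>
     - net_outflow G f t = q"

definition flow_cost ::
  "('v,'e) pre_digraph \<Rightarrow> ('e \<Rightarrow> real \<Rightarrow> real) \<Rightarrow> ('e \<Rightarrow> real) \<Rightarrow> real" where
  "flow_cost G l f = (\<Sum>e\<in>arcs G. f e * l e (f e))"

text \<open>Paths are simple, i.e. they do not repeat vertices.\<close>

definition st_paths :: "('v,'e) pre_digraph \<Rightarrow> 'v \<Rightarrow> 'v \<Rightarrow> 'e list set" where
  "st_paths G s t = {p. pre_digraph.apath G s p t}"

definition path_latency :: "('e \<Rightarrow> real \<Rightarrow> real) \<Rightarrow> ('e \<Rightarrow> real) \<Rightarrow> 'e list \<Rightarrow> real" where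
  "path_latency l f p = (\<Sum>e\<leftarrow>p. l e (f e))"

definition path_decomposition ::
  "('v,'e) pre_digraph \<Rightarrow> 'v \<Rightarrow> 'v \<Rightarrow> ('e \<Rightarrow> real) \<Rightarrow> ('e list \<Rightarrow> real) \<Rightarrow> bool" where
  "path_decomposition G s t f h \<longleftrightarrow>
     (\<forall>p\<in>st_paths G s t. 0 \<le> h p) \<and>
     (\<forall>e\<in>arcs G. f e = (\<Sum>p | p \<in> st_paths G s t \<and> e \<in> set p. h p))"

definition user_equilibrium ::
  "('v,'e) pre_digraph \<Rightarrow> 'v \<Rightarrow> 'v \<Rightarrow> real \<Rightarrow> ('e \<Rightarrow> real \<Rightarrow> real) \<Rightarrow> ('e \<Rightarrow> real) \<Rightarrow> bool" where
  "user_equilibrium G s t q l f \<longleftrightarrow>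
     feasible_flow G s t q f \<and>
     (\<exists>h. path_decomposition G s t f h \<and>
       (\<forall>p\<in>st_paths G s t. 0 < h p \<longrightarrow>
         (\<forall>p'\<in>st_paths G s t. path_latency l f p \<le> path_latency l f p')))"

type_synonym vertex = "nat \<times> nat"
type_synonym edge = "vertex \<times> vertex"

definition grid :: "nat \<Rightarrow> nat \<Rightarrow> (vertex, edge) pre_digraph" where
  "grid m n =
     \<lparr> verts = {0..m} \<times> {0..n},
       arcs = {((i, j), (i + 1, j)) | i j. i < m \<and> j \<le> n}
            \<union> {((i, j), (i, j + 1)) | i j. i \<le> m \<and> j < n},
       tail = fst, head = snd \<rparr>"

definition is_chord :: "nat \<Rightarrow> nat \<Rightarrow> vertex \<Rightarrow> vertex \<Rightarrow> bool" where
  "is_chord m n u v \<longleftrightarrow>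
     u \<in> verts (grid m n) \<and> v \<in> verts (grid m n) \<and> u \<noteq> v \<and>
     (u, v) \<notin> arcs (grid m n) \<and> (v, u) \<notin> arcs (grid m n)"

definition grid_with_chord :: "nat \<Rightarrow> nat \<Rightarrow> vertex \<Rightarrow> vertex \<Rightarrow> (vertex, edge) pre_digraph" where
  "grid_with_chord m n u v = pre_digraph.add_arc (grid m n) (u, v)"

definition grid_latency :: "real \<Rightarrow> real \<Rightarrow> edge \<Rightarrow> real \<Rightarrow> real" where
  "grid_latency a b e x = a * x + b"

definition chord_latency ::
  "real \<Rightarrow> real \<Rightarrow> real \<Rightarrow> real \<Rightarrow> vertex \<Rightarrow> vertex \<Rightarrow> edge \<Rightarrow> real \<Rightarrow> real" where
  "chord_latency a b c d u v = (grid_latency a b)((u, v) := (\<lambda>x. c * x + d))"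

text \<open>
  The ratio is taken for given equilibria \<open>f\<close> of the grid and \<open>g\<close> of the grid with chord.
  Equilibrium flows on these networks are unique, so it does not depend on their choice.
\<close>

definition braess_ratio ::
  "nat \<Rightarrow> nat \<Rightarrow> real \<Rightarrow> real \<Rightarrow> real \<Rightarrow> real \<Rightarrow> vertex \<Rightarrow> vertex \<Rightarrow>
   (edge \<Rightarrow> real) \<Rightarrow> (edge \<Rightarrow> real) \<Rightarrow> real" where
  "braess_ratio m n a b c d u v f g =
     flow_cost (grid_with_chord m n u v) (chord_latency a b c d u v) g /
     flow_cost (grid m n) (grid_latency a b) f"

end

theory Submission
  imports Defs "HOL-Analysis.Convex"
begin

text \<open>
  Write \<open>\<delta>\<close> for the change \<open>g - f\<close> of the flow on the grid arcs, \<open>x\<close> for the chord flow,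
  \<open>L\<close> for the number of levels that the chord climbs, and \<open>\<epsilon> = a \<langle>f, \<delta>\<rangle>\<close>. Testing the equilibrium
  \<open>g\<close> against \<open>f\<close> shows that the cost rises by at most \<open>\<epsilon>\<close> and that
  \<open>a \<bar>\<delta>\<bar>\<^sup>2 \<le> b L x - \<epsilon>\<close>, so Cauchy-Schwarz gives \<open>\<epsilon>\<^sup>2 \<le> a \<bar>f\<bar>\<^sup>2 (b L x - \<epsilon>)\<close>.
  The old cost is \<open>a \<bar>f\<bar>\<^sup>2 + b (m + n) q\<close> and \<open>x \<le> q\<close>; if \<open>L \<le> max m n - 1\<close>, the bound
  follows by AM-GM.

  The remaining chords go weakly upwards in both coordinates. The flow \<open>f\<close> is
  the electrical flow of a potential that increases along all grid arcs, so for them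
  \<open>\<epsilon>\<close>, which is \<open>x\<close> times the potential at the tail minus that at the head, is not positive.
\<close>

section \<open>Path decompositions and consequences of equilibrium\<close>

lemma telescope_awalk:
  fixes \<chi> :: "'v \<Rightarrow> real"
  shows "pre_digraph.cas G s p t \<Longrightarrow> (\<Sum>e\<leftarrow>p. \<chi> (head G e) - \<chi> (tail G e)) = \<chi> t - \<chi> s"
  by (induction p arbitrary: s) (auto simp: pre_digraph.cas.simps)

lemma finite_st_paths: "fin_digraph G \<Longrightarrow> finite (st_paths G s t)"
  unfolding st_paths_def by (rule fin_digraph.apaths_finite)

lemma st_pathsD:
  assumes "p \<in> st_paths G s t"
  shows "pre_digraph.cas G s p t" "set p \<subseteq> arcs G"
  using assms by (auto simp: st_paths_def pre_digraph.apath_def pre_digraph.awalk_def)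

lemma distinct_st_path:
  assumes "fin_digraph G" "p \<in> st_paths G s t"
  shows "distinct p"
proof -
  interpret fin_digraph G by fact
  have "apath s p t" using assms by (simp add: st_paths_def)
  then show ?thesis using apath_def distinct_verts_imp_distinct by blast
qed

text \<open>Exchange of summation; simple paths have distinct arcs, so each arc of a path counts
  once.\<close>

lemma path_decomposition_sum:
  assumes G: "fin_digraph G" and h: "path_decomposition G s t f h"
  shows "(\<Sum>e\<in>arcs G. f e * \<phi> e) = (\<Sum>p\<in>st_paths G s t. h p * (\<Sum>e\<leftarrow>p. \<phi> e))"
proof -
  let ?P = "st_paths G s t"
  note fP = finite_st_paths[OF G, of s t]
  have fA: "finite (arcs G)" using G by (simp add: fin_digraph.finite_arcs)
  have "(\<Sum>e\<in>arcs G. f e * \<phi> e) = (\<Sum>e\<in>arcs G. \<Sum>p\<in>?P. if e \<in> set p then h p * \<phi> e else 0)"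
  proof (intro sum.cong refl)
    fix e assume "e \<in> arcs G"
    then have "f e = (\<Sum>p | p \<in> ?P \<and> e \<in> set p. h p)"
      using h by (simp add: path_decomposition_def)
    then show "f e * \<phi> e = (\<Sum>p\<in>?P. if e \<in> set p then h p * \<phi> e else 0)"
      by (simp add: sum_distrib_right sum.inter_filter[OF fP])
         (auto intro!: sum.cong)
  qed
  also have "\<dots> = (\<Sum>p\<in>?P. \<Sum>e\<in>arcs G. if e \<in> set p then h p * \<phi> e else 0)"
    by (rule sum.swap)
  also have "\<dots> = (\<Sum>p\<in>?P. h p * (\<Sum>e\<leftarrow>p. \<phi> e))"
  proof (intro sum.cong refl)
    fix p assume p: "p \<in> ?P"
    have "(\<Sum>e\<leftarrow>p. \<phi> e) = (\<Sum>e\<in>set p. \<phi> e)"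
      using distinct_st_path[OF G p] by (simp add: sum_list_distinct_conv_sum_set)
    moreover have "{e \<in> arcs G. e \<in> set p} = set p" using st_pathsD[OF p] by auto
    ultimately show "(\<Sum>e\<in>arcs G. if e \<in> set p then h p * \<phi> e else 0) = h p * (\<Sum>e\<leftarrow>p. \<phi> e)"
      by (simp add: sum.inter_filter[OF fA, symmetric] sum_distrib_left)
  qed
  finally show ?thesis .
qed

text \<open>Differences of \<open>\<chi>\<close> telescope along each path, so only the total path
  flow and the end values survive. Suitable choices of \<open>\<chi>\<close> yield net outflows,
  sums of arc flows and shortest-path bounds.\<close>

lemma path_decomposition_gradient:
  assumes G: "fin_digraph G" and h: "path_decomposition G s t f h"
  shows "(\<Sum>e\<in>arcs G. f e * (\<chi> (head G e) - \<chi> (tail G e)))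
           = (\<Sum>p\<in>st_paths G s t. h p) * (\<chi> t - \<chi> s)"
  unfolding path_decomposition_sum[OF G h] sum_distrib_right
  by (intro sum.cong refl) (simp add: telescope_awalk[OF st_pathsD(1)])

lemma net_outflow_conv:
  assumes "fin_digraph G"
  shows "net_outflow G f w
           = (\<Sum>e\<in>arcs G. f e * (of_bool (tail G e = w) - of_bool (head G e = w)))"
proof -
  have fA: "finite (arcs G)" using assms by (simp add: fin_digraph.finite_arcs)
  show ?thesis
    unfolding net_outflow_def out_arcs_def in_arcs_def right_diff_distrib sum_subtractf
      sum.inter_filter[OF fA]
    by (intro arg_cong2[of _ _ _ _ minus] sum.cong) auto
qed

text \<open>Minus the indicator of \<open>s\<close> rises by 1 from \<open>s\<close> to
  \<open>t\<close>, and its gradient pairs with \<open>f\<close> to the net outflow at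
  \<open>s\<close>.\<close>

lemma path_decomposition_total:
  assumes G: "fin_digraph G" and h: "path_decomposition G s t f h" and "s \<noteq> t"
  shows "(\<Sum>p\<in>st_paths G s t. h p) = net_outflow G f s"
  using path_decomposition_gradient[OF G h, of "\<lambda>w. - of_bool (w = s)"] assms(3)
  by (simp add: net_outflow_conv[OF G] algebra_simps)

text \<open>These facts eliminate the path flows from the equilibrium condition. For the cost bound,
  the cost is the sum of path latencies weighted by path flows, and no path carrying flow is slower
  than \<open>p\<close>.\<close>

lemma user_equilibrium_facts:
  assumes G: "fin_digraph G" and ue: "user_equilibrium G s t q l f" and st: "s \<noteq> t"
  shows user_equilibrium_gradient:
      "(\<Sum>e\<in>arcs G. f e * (\<chi> (head G e) - \<chi> (tail G e))) = q * (\<chi> t - \<chi> s)"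
    and user_equilibrium_cost_le:
      "p \<in> st_paths G s t \<Longrightarrow> flow_cost G l f \<le> q * path_latency l f p"
    and user_equilibrium_le_demand: "e \<in> arcs G \<Longrightarrow> f e \<le> q"
    and user_equilibrium_nonneg: "e \<in> arcs G \<Longrightarrow> 0 \<le> f e"
proof -
  let ?P = "st_paths G s t"
  obtain h where h: "path_decomposition G s t f h"
    and opt: "\<And>p p'. p \<in> ?P \<Longrightarrow> 0 < h p \<Longrightarrow> p' \<in> ?P \<Longrightarrow> path_latency l f p \<le> path_latency l f p'"
    using ue unfolding user_equilibrium_def by blast
  have tot: "(\<Sum>p\<in>?P. h p) = q"
    using path_decomposition_total[OF G h st] ue
    by (simp add: user_equilibrium_def feasible_flow_def)
  have h0: "0 \<le> h p" if "p \<in> ?P" for p using h that by (simp add: path_decomposition_def)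
  show "(\<Sum>e\<in>arcs G. f e * (\<chi> (head G e) - \<chi> (tail G e))) = q * (\<chi> t - \<chi> s)"
    by (simp add: path_decomposition_gradient[OF G h] tot)
  show "flow_cost G l f \<le> q * path_latency l f p" if p: "p \<in> ?P"
  proof -
    have "flow_cost G l f = (\<Sum>p'\<in>?P. h p' * path_latency l f p')"
      by (simp add: flow_cost_def path_decomposition_sum[OF G h] path_latency_def)
    also have "\<dots> \<le> (\<Sum>p'\<in>?P. h p' * path_latency l f p)"
    proof (rule sum_mono)
      fix p' assume p': "p' \<in> ?P"
      show "h p' * path_latency l f p' \<le> h p' * path_latency l f p"
        using opt[OF p' _ p] h0[OF p'] by (cases "h p' = 0") (auto intro!: mult_left_mono)
    qed
    finally show ?thesis by (simp add: sum_distrib_right[symmetric] tot)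
  qed
  show "f e \<le> q" if e: "e \<in> arcs G"
  proof -
    have "f e = (\<Sum>p | p \<in> ?P \<and> e \<in> set p. h p)"
      using h e by (simp add: path_decomposition_def)
    also have "\<dots> \<le> (\<Sum>p\<in>?P. h p)"
      by (rule sum_mono2) (auto simp: finite_st_paths[OF G] h0)
    finally show ?thesis by (simp add: tot)
  qed
  show "0 \<le> f e" if "e \<in> arcs G"
    using ue that by (simp add: user_equilibrium_def feasible_flow_def)
qed

section \<open>Shortest monotone paths in the grid\<close>

lemma apath_snoc:
  assumes "wf_digraph G" "pre_digraph.apath G s p (tail G e)" "e \<in> arcs G"
    and "head G e \<notin> set (pre_digraph.awalk_verts G s p)"
  shows "pre_digraph.apath G s (p @ [e]) (head G e)"
    and "set (pre_digraph.awalk_verts G s (p @ [e]))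
           = insert (head G e) (set (pre_digraph.awalk_verts G s p))"
proof -
  interpret wf_digraph G by fact
  have w: "awalk s p (tail G e)" and d: "distinct (awalk_verts s p)"
    using assms(2) by (auto simp: apath_def)
  have e: "awalk (tail G e) [e] (head G e)" using assms(3) by (simp add: awalk_simps)
  have aw: "awalk s (p @ [e]) (head G e)" using awalk_appendI[OF w e] .
  have "awalk_verts s (p @ [e]) = awalk_verts s p @ [head G e]"
    using awalk_verts_append[OF aw] w by (simp add: awalk_ends)
  then show "apath s (p @ [e]) (head G e)"
    and "set (awalk_verts s (p @ [e])) = insert (head G e) (set (awalk_verts s p))"
    using aw d assms(4) by (auto simp: apath_def)
qed

text \<open>Dynamic programming for the shortest distance from the origin along grid arcs only. A
  chord is ignored, so the same function serves both networks.\<close>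

fun grid_dist :: "(edge \<Rightarrow> real) \<Rightarrow> vertex \<Rightarrow> real" where
  "grid_dist w (0, 0) = 0"
| "grid_dist w (Suc i, 0) = grid_dist w (i, 0) + w ((i, 0), (Suc i, 0))"
| "grid_dist w (0, Suc j) = grid_dist w (0, j) + w ((0, j), (0, Suc j))"
| "grid_dist w (Suc i, Suc j) =
     min (grid_dist w (i, Suc j) + w ((i, Suc j), (Suc i, Suc j)))
         (grid_dist w (Suc i, j) + w ((Suc i, j), (Suc i, Suc j)))"

lemma grid_arc_cases:
  assumes "e \<in> arcs (grid m n)"
  obtains (X) i j where "e = ((i, j), (Suc i, j))" "i < m" "j \<le> n"
        | (Y) i j where "e = ((i, j), (i, Suc j))" "i \<le> m" "j < n"
  using assms by (auto simp: grid_def)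

lemma grid_dist_le:
  "grid_dist w (head (grid m n) e) \<le> grid_dist w (tail (grid m n) e) + w e"
  if "e \<in> arcs (grid m n)"
  using that
proof (cases e rule: grid_arc_cases)
  case (X i j) then show ?thesis by (cases j) (auto simp: grid_def)
next
  case (Y i j) then show ?thesis by (cases i) (auto simp: grid_def)
qed

text \<open>The path is extended along an arc attaining the minimum in the recursion. The rectangle
  containing its vertices is carried along to show that each appended vertex is new.
  \<open>G\<close> may have further arcs, so the grid with a chord is covered.\<close>

lemma grid_dist_path:
  assumes G: "wf_digraph G" "verts G = verts (grid m n)" "arcs (grid m n) \<subseteq> arcs G"
    "tail G = fst" "head G = snd"
  shows "i \<le> m \<Longrightarrow> j \<le> n \<Longrightarrow> \<exists>p. pre_digraph.apath G (0, 0) p (i, j)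
     \<and> set (pre_digraph.awalk_verts G (0, 0) p) \<subseteq> {..i} \<times> {..j}
     \<and> (\<Sum>e\<leftarrow>p. w e) = grid_dist w (i, j)"
proof -
  interpret wf_digraph G by (rule G)
  let ?P = "\<lambda>i j p. apath (0, 0) p (i, j) \<and> set (awalk_verts (0, 0) p) \<subseteq> {..i} \<times> {..j}"
  have X: "?P (Suc i) j (p @ [((i, j), (Suc i, j))])" if "?P i j p" "i < m" "j \<le> n" for i j p
  proof -
    have e: "((i, j), (Suc i, j)) \<in> arcs G" using that G(3) by (auto simp: grid_def)
    have "(Suc i, j) \<notin> set (awalk_verts (0, 0) p)" using that by auto
    with apath_snoc[OF G(1) _ e, of "(0, 0)" p] that show ?thesis by (simp add: G) force
  qed
  have Y: "?P i (Suc j) (p @ [((i, j), (i, Suc j))])" if "?P i j p" "i \<le> m" "j < n" for i j p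
  proof -
    have e: "((i, j), (i, Suc j)) \<in> arcs G" using that G(3) by (auto simp: grid_def)
    have "(i, Suc j) \<notin> set (awalk_verts (0, 0) p)" using that by auto
    with apath_snoc[OF G(1) _ e, of "(0, 0)" p] that show ?thesis by (simp add: G) force
  qed
  have "i \<le> m \<Longrightarrow> j \<le> n \<Longrightarrow> \<exists>p. ?P i j p \<and> (\<Sum>e\<leftarrow>p. w e) = grid_dist w (i, j)"
    for i j
  proof (induction w "(i, j)" arbitrary: i j rule: grid_dist.induct)
    case (1 w)
    show ?case by (rule exI[of _ "[]"]) (simp add: apath_simps awalk_verts.simps G grid_def)
  next
    case (2 w i)
    then obtain p where "?P i 0 p" "(\<Sum>e\<leftarrow>p. w e) = grid_dist w (i, 0)" by auto
    with X[of p i 0] 2(2,3) show ?case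
      by (intro exI[of _ "p @ [((i, 0), (Suc i, 0))]"]) auto
  next
    case (3 w j)
    then obtain p where "?P 0 j p" "(\<Sum>e\<leftarrow>p. w e) = grid_dist w (0, j)" by auto
    with Y[of p 0 j] 3(2,3) show ?case
      by (intro exI[of _ "p @ [((0, j), (0, Suc j))]"]) auto
  next
    case (4 w i j)
    obtain p where p: "?P i (Suc j) p" "(\<Sum>e\<leftarrow>p. w e) = grid_dist w (i, Suc j)"
      using 4 by auto
    obtain p' where p': "?P (Suc i) j p'" "(\<Sum>e\<leftarrow>p'. w e) = grid_dist w (Suc i, j)"
      using 4 by auto
    show ?case
    proof (cases "grid_dist w (i, Suc j) + w ((i, Suc j), (Suc i, Suc j))
        \<le> grid_dist w (Suc i, j) + w ((Suc i, j), (Suc i, Suc j))")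
      case True
      with X[of p i "Suc j"] p 4(3,4) show ?thesis
        by (intro exI[of _ "p @ [((i, Suc j), (Suc i, Suc j))]"]) auto
    next
      case False
      with Y[of p' "Suc i" j] p' 4(3,4) show ?thesis
        by (intro exI[of _ "p' @ [((Suc i, j), (Suc i, Suc j))]"]) auto
    qed
  qed
  then show "i \<le> m \<Longrightarrow> j \<le> n \<Longrightarrow> \<exists>p. apath (0, 0) p (i, j)
     \<and> set (awalk_verts (0, 0) p) \<subseteq> {..i} \<times> {..j} \<and> (\<Sum>e\<leftarrow>p. w e) = grid_dist w (i, j)"
    by auto
qed

section \<open>The electrical potential of the grid equilibrium\<close>

lemma fin_digraph_grid: "fin_digraph (grid m n)"
proof
  have "arcs (grid m n) \<subseteq> verts (grid m n) \<times> verts (grid m n)" by (auto simp: grid_def)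
  then show "finite (arcs (grid m n))" by (rule finite_subset) (simp add: grid_def)
qed (auto simp: grid_def)

text \<open>\<open>X i j\<close> and \<open>Y i j\<close> are the flows entering
  \<open>(i, j)\<close> horizontally and vertically. Padding with zero outside the grid gives one
  balance formula without boundary cases.\<close>

lemma grid_conservation:
  fixes X Y :: "nat \<Rightarrow> nat \<Rightarrow> real" and f :: "edge \<Rightarrow> real" and m n :: nat
  defines "X \<equiv> \<lambda>i j. case i of 0 \<Rightarrow> 0 | Suc i' \<Rightarrow> if i' < m then f ((i', j), (i, j)) else 0"
    and "Y \<equiv> \<lambda>i j. case j of 0 \<Rightarrow> 0 | Suc j' \<Rightarrow> if j' < n then f ((i, j'), (i, j)) else 0"
  assumes "i \<le> m" "j \<le> n"
  shows "net_outflow (grid m n) f (i, j) = X (Suc i) j + Y i (Suc j) - X i j - Y i j"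
proof -
  have out: "out_arcs (grid m n) (i, j)
      = (if i < m then {((i, j), (Suc i, j))} else {}) \<union> (if j < n then {((i, j), (i, Suc j))} else {})"
    using assms(3,4) by (auto simp: out_arcs_def grid_def)
  have inn: "in_arcs (grid m n) (i, j)
      = (case i of 0 \<Rightarrow> {} | Suc i' \<Rightarrow> {((i', j), (i, j))}) \<union>
        (case j of 0 \<Rightarrow> {} | Suc j' \<Rightarrow> {((i, j'), (i, j))})"
    using assms(3,4) by (auto simp: in_arcs_def grid_def split: nat.splits)
  show ?thesis
    unfolding net_outflow_def out inn X_def Y_def using assms(3,4)
    by (auto split: nat.splits)
qed

text \<open>
  A discrete minimum principle. Subtracting the balance at \<open>(i, j)\<close> from the one at
  \<open>(i + 1, j)\<close> gives a second-order equation for the horizontal potential difference, which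
  fails at a negative minimum with \<open>j\<close> as small as possible. The flow vanishes where the
  potential decreases, so strictness at the minimum has to come from the tight incoming edge.
\<close>

lemma grid_potential_horizontal_mono:
  fixes X Y \<psi> :: "nat \<Rightarrow> nat \<Rightarrow> real"
  assumes a: "0 < a" and q: "0 \<le> q"
    and X: "\<And>i j. i < m \<Longrightarrow> j \<le> n \<Longrightarrow> a * X (Suc i) j = max 0 (\<psi> (Suc i) j - \<psi> i j)"
    and Y: "\<And>i j. i \<le> m \<Longrightarrow> j < n \<Longrightarrow> a * Y i (Suc j) = max 0 (\<psi> i (Suc j) - \<psi> i j)"
    and X0: "\<And>j. X 0 j = 0" "\<And>j. X (Suc m) j = 0"
    and Yn: "\<And>i. Y i (Suc n) = 0"
    and bal: "\<And>i j. i \<le> m \<Longrightarrow> j \<le> n \<Longrightarrow> X (Suc i) j + Y i (Suc j) - X i j - Y i j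
        = (if i = 0 \<and> j = 0 then q else 0) - (if i = m \<and> j = n then q else 0)"
    and tight0: "\<And>i. i < m \<Longrightarrow> \<psi> i 0 \<le> \<psi> (Suc i) 0"
    and tight: "\<And>i j. i < m \<Longrightarrow> j < n \<Longrightarrow>
        \<psi> i (Suc j) \<le> \<psi> (Suc i) (Suc j) \<or> \<psi> (Suc i) j \<le> \<psi> (Suc i) (Suc j)"
    and ij: "i < m" "j \<le> n"
  shows "\<psi> i j \<le> \<psi> (Suc i) j"
proof (rule ccontr)
  assume neg: "\<not> \<psi> i j \<le> \<psi> (Suc i) j"
  define D where "D i j = \<psi> (Suc i) j - \<psi> i j" for i j
  let ?S = "{..<m} \<times> {..n}"
  let ?V = "(\<lambda>(i, j). D i j) ` ?S"
  have fin: "finite ?V" "?V \<noteq> {}" using ij by auto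
  define \<mu> where "\<mu> = Min ?V"
  have \<mu>: "\<mu> \<le> D i j" if "i < m" "j \<le> n" for i j
    unfolding \<mu>_def using that by (intro Min_le fin) auto
  have "\<mu> \<in> ?V" unfolding \<mu>_def by (rule Min_in[OF fin])
  then have "\<exists>j. \<exists>i<m. j \<le> n \<and> D i j = \<mu>" by auto
  then obtain k where k: "\<exists>i<m. k \<le> n \<and> D i k = \<mu>"
    and low: "\<And>k'. k' < k \<Longrightarrow> \<not> (\<exists>i<m. k' \<le> n \<and> D i k' = \<mu>)"
    using exists_least_iff[of "\<lambda>j. \<exists>i<m. j \<le> n \<and> D i j = \<mu>"] by blast
  then obtain h where h: "h < m" "k \<le> n" "D h k = \<mu>" by blast
  have \<mu>0: "\<mu> < 0" using neg \<mu>[OF ij] by (simp add: D_def)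
  have "k \<noteq> 0" using tight0[OF h(1)] h(3) \<mu>0 by (intro notI) (simp add: D_def)
  then obtain l where l: "k = Suc l" by (cases k) auto
  have Dl: "D h k < D h l" using \<mu>[of h l] low[of l] h l by force
  have Xh: "a * X (Suc h) k = 0" using X[OF h(1,2)] h(3) \<mu>0 by (simp add: D_def)
  have Xr: "0 \<le> a * X (Suc (Suc h)) k"
    using X[of "Suc h" k] X0(2)[of k] h by (cases "Suc h < m") (auto simp: not_less_eq less_Suc_eq)
  have Xl: "0 \<le> a * X h k" using X[of "h - 1" k] X0(1) h by (cases h) auto
  \<comment> \<open>\<open>D h (Suc k)\<close> is at least \<open>\<mu>\<close>, so the vertical
    increase in column \<open>Suc h\<close> is at least that in column \<open>h\<close>, and
    \<open>max 0\<close> keeps the order.\<close>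
  have up: "a * Y h (Suc k) \<le> a * Y (Suc h) (Suc k)"
  proof (cases "k < n")
    case True
    then show ?thesis using Y[of h k] Y[of "Suc h" k] \<mu>[of h "Suc k"] h by (auto simp: D_def)
  next
    case False
    then show ?thesis using Yn h by simp
  qed
  \<comment> \<open>The first alternative in \<open>tight\<close> fails as \<open>\<mu> < 0\<close>,
    so the vertical arc into \<open>(Suc h, k)\<close> has a nonnegative increase; this keeps the
    inequality strict under \<open>max 0\<close>.\<close>
  have down: "a * Y (Suc h) k < a * Y h k"
    using Y[of h l] Y[of "Suc h" l] tight[of h l] h Dl l \<mu>0 by (auto simp: D_def)
  \<comment> \<open>\<open>(h, k)\<close> is not the sink and \<open>(Suc h, k)\<close> is not the
    source, so the demand terms have the right signs.\<close>
  have "X (Suc h) k + Y h (Suc k) - X h k - Y h k \<ge> 0"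
    using bal[of h k] h q by auto
  moreover have "X (Suc (Suc h)) k + Y (Suc h) (Suc k) - X (Suc h) k - Y (Suc h) k \<le> 0"
    using bal[of "Suc h" k] h q by auto
  ultimately have "(X (Suc (Suc h)) k + Y (Suc h) (Suc k) - X (Suc h) k - Y (Suc h) k)
      \<le> (X (Suc h) k + Y h (Suc k) - X h k - Y h k)" by linarith
  from mult_left_mono[OF this less_imp_le[OF a]] show False
    using Xh Xr Xl up down by (simp add: algebra_simps)
qed

lemma grid_equilibrium_potential:
  assumes mn: "0 < m + n" and a: "0 < a" and q: "0 < q"
    and ue: "user_equilibrium (grid m n) (0, 0) (m, n) q (grid_latency a b) f"
  obtains \<psi> :: "vertex \<Rightarrow> real"
  where "\<And>e. e \<in> arcs (grid m n) \<Longrightarrow> a * f e = \<psi> (head (grid m n) e) - \<psi> (tail (grid m n) e)"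
proof -
  let ?G = "grid m n"
  have st: "(0, 0) \<noteq> (m, n)" using mn by auto
  note facts = user_equilibrium_facts[OF fin_digraph_grid ue st]
  define w where "w e = grid_latency a b e (f e)" for e
  define \<pi> where "\<pi> = grid_dist w"
  have le: "\<pi> (head ?G e) - \<pi> (tail ?G e) \<le> w e" if "e \<in> arcs ?G" for e
    using grid_dist_le[OF that, of w] by (simp add: \<pi>_def)
  obtain p where p: "p \<in> st_paths ?G (0, 0) (m, n)" "(\<Sum>e\<leftarrow>p. w e) = \<pi> (m, n)"
    using grid_dist_path[of ?G m n m n w] fin_digraph_grid[of m n]
    by (auto simp: st_paths_def \<pi>_def fin_digraph_def grid_def)
  \<comment> \<open>Complementary slackness: the cost is at most that of shortest paths while every
    arc has nonnegative slack, so the slack vanishes wherever there is flow.\<close>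
  have "(\<Sum>e\<in>arcs ?G. f e * w e) \<le> q * \<pi> (m, n)"
    using facts(2)[OF p(1)] p(2) by (simp add: flow_cost_def path_latency_def w_def)
  also have "\<dots> = (\<Sum>e\<in>arcs ?G. f e * (\<pi> (head ?G e) - \<pi> (tail ?G e)))"
    by (simp add: facts(1) \<pi>_def)
  finally have "(\<Sum>e\<in>arcs ?G. f e * (w e - (\<pi> (head ?G e) - \<pi> (tail ?G e)))) \<le> 0"
    by (simp add: right_diff_distrib sum_subtractf)
  moreover have slack: "0 \<le> f e * (w e - (\<pi> (head ?G e) - \<pi> (tail ?G e)))" if "e \<in> arcs ?G" for e
    using facts(4)[OF that] le[OF that] by simp
  ultimately have "(\<Sum>e\<in>arcs ?G. f e * (w e - (\<pi> (head ?G e) - \<pi> (tail ?G e)))) = 0"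
    by (intro antisym sum_nonneg) auto
  then have "\<forall>e\<in>arcs ?G. f e * (w e - (\<pi> (head ?G e) - \<pi> (tail ?G e))) = 0"
    using sum_nonneg_eq_0_iff[OF fin_digraph.finite_arcs[OF fin_digraph_grid] slack] by simp
  then have eq: "f e = 0 \<or> w e = \<pi> (head ?G e) - \<pi> (tail ?G e)" if "e \<in> arcs ?G" for e
    using that by auto
  \<comment> \<open>Every grid arc climbs one level, so subtracting \<open>b\<close> per level
    removes the constant part of the latency.\<close>
  define \<psi> where "\<psi> v = \<pi> v - b * real (fst v + snd v)" for v
  have step: "\<psi> (head ?G e) - \<psi> (tail ?G e) = \<pi> (head ?G e) - \<pi> (tail ?G e) - b" if "e \<in> arcs ?G" for e
    using that by (cases e rule: grid_arc_cases) (auto simp: grid_def \<psi>_def algebra_simps)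
  have flow: "a * f e = max 0 (\<psi> (head ?G e) - \<psi> (tail ?G e))" if "e \<in> arcs ?G" for e
    using eq[OF that] le[OF that] step[OF that] mult_nonneg_nonneg[OF less_imp_le[OF a] facts(4)[OF that]]
    by (auto simp: w_def grid_latency_def max_def)
  define X Y where
    "X = (\<lambda>i j. case i of 0 \<Rightarrow> 0 | Suc i' \<Rightarrow> if i' < m then f ((i', j), (i, j)) else 0)" and
    "Y = (\<lambda>i j. case j of 0 \<Rightarrow> 0 | Suc j' \<Rightarrow> if j' < n then f ((i, j'), (i, j)) else 0)"
  have X: "a * X (Suc i) j = max 0 (\<psi> (Suc i, j) - \<psi> (i, j))" if "i < m" "j \<le> n" for i j
    using flow[of "((i, j), (Suc i, j))"] that by (auto simp: X_def grid_def)
  have Y: "a * Y i (Suc j) = max 0 (\<psi> (i, Suc j) - \<psi> (i, j))" if "i \<le> m" "j < n" for i j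
    using flow[of "((i, j), (i, Suc j))"] that by (auto simp: Y_def grid_def)
  have bal: "X (Suc i) j + Y i (Suc j) - X i j - Y i j
      = (if i = 0 \<and> j = 0 then q else 0) - (if i = m \<and> j = n then q else 0)"
    if "i \<le> m" "j \<le> n" for i j
  proof -
    have "net_outflow ?G f (i, j)
        = (if i = 0 \<and> j = 0 then q else 0) - (if i = m \<and> j = n then q else 0)"
      using ue that st by (auto simp: user_equilibrium_def feasible_flow_def grid_def)
    then show ?thesis using grid_conservation[OF that, of f] by (simp add: X_def Y_def)
  qed
  have fX: "0 \<le> f ((i, j), (Suc i, j))" if "i < m" "j \<le> n" for i j
    using that by (intro facts(4)) (auto simp: grid_def)
  have fY: "0 \<le> f ((i, j), (i, Suc j))" if "i \<le> m" "j < n" for i j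
    using that by (intro facts(4)) (auto simp: grid_def)
  \<comment> \<open>An arc attaining the recursion of \<open>grid_dist\<close> raises
    \<open>\<psi>\<close> by \<open>a\<close> times a nonnegative flow. On the axes this is the only
    incoming arc, elsewhere one of two.\<close>
  have tX: "\<psi> (i, 0) \<le> \<psi> (Suc i, 0)" if "i < m" for i
    using a fX[of i 0] that by (simp add: \<psi>_def \<pi>_def w_def grid_latency_def algebra_simps)
  have tY: "\<psi> (0, j) \<le> \<psi> (0, Suc j)" if "j < n" for j
    using a fY[of 0 j] that by (simp add: \<psi>_def \<pi>_def w_def grid_latency_def algebra_simps)
  have t: "\<psi> (i, Suc j) \<le> \<psi> (Suc i, Suc j) \<or> \<psi> (Suc i, j) \<le> \<psi> (Suc i, Suc j)"
    if "i < m" "j < n" for i j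
    using mult_nonneg_nonneg[OF less_imp_le[OF a] fX[of i "Suc j"]]
      mult_nonneg_nonneg[OF less_imp_le[OF a] fY[of "Suc i" j]] that
    by (auto simp: \<psi>_def \<pi>_def w_def grid_latency_def algebra_simps min_def)
  have bd: "X 0 j = 0" "X (Suc m) j = 0" "Y i 0 = 0" "Y i (Suc n) = 0" for i j
    by (simp_all add: X_def Y_def)
  have mX: "\<psi> (i, j) \<le> \<psi> (Suc i, j)" if "i < m" "j \<le> n" for i j
    by (rule grid_potential_horizontal_mono[where \<psi> = "\<lambda>i j. \<psi> (i, j)",
          OF a less_imp_le[OF q] X Y bd(1,2,4) bal tX t that])
  \<comment> \<open>The vertical case is the horizontal one with the coordinates exchanged.\<close>
  have bal': "Y i (Suc j) + X (Suc i) j - Y i j - X i j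
      = (if j = 0 \<and> i = 0 then q else 0) - (if j = n \<and> i = m then q else 0)"
    if "j \<le> n" "i \<le> m" for j i
    using bal[OF that(2,1)] by (simp add: conj_commute)
  have t': "\<psi> (Suc i, j) \<le> \<psi> (Suc i, Suc j) \<or> \<psi> (i, Suc j) \<le> \<psi> (Suc i, Suc j)"
    if "j < n" "i < m" for j i using t[OF that(2,1)] by blast
  have mY: "\<psi> (i, j) \<le> \<psi> (i, Suc j)" if "i \<le> m" "j < n" for i j
    by (rule grid_potential_horizontal_mono[where \<psi> = "\<lambda>j i. \<psi> (i, j)"
            and X = "\<lambda>j i. Y i j" and Y = "\<lambda>j i. X i j",
          OF a less_imp_le[OF q] Y X bd(3,4,2) bal' tY t' that(2,1)])
  have "a * f e = \<psi> (head ?G e) - \<psi> (tail ?G e)" if e: "e \<in> arcs ?G" for e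
    using e flow[OF e] mX mY by (cases e rule: grid_arc_cases) (auto simp: grid_def)
  then show thesis by (rule that)
qed

lemma grid_potential_mono:
  fixes \<psi> :: "vertex \<Rightarrow> real"
  assumes "\<And>e. e \<in> arcs (grid m n) \<Longrightarrow> \<psi> (tail (grid m n) e) \<le> \<psi> (head (grid m n) e)"
    and "i \<le> i'" "j \<le> j'" "i' \<le> m" "j' \<le> n"
  shows "\<psi> (i, j) \<le> \<psi> (i', j')"
proof -
  have "i' \<le> m \<longrightarrow> \<psi> (i, j) \<le> \<psi> (i', j)" using assms(2)
  proof (induction i' rule: dec_induct)
    case (step k)
    then show ?case
      using assms(1)[of "((k, j), (Suc k, j))"] assms(3,5) by (auto simp: grid_def)
  qed simp
  moreover have "j' \<le> n \<longrightarrow> \<psi> (i', j) \<le> \<psi> (i', j')" using assms(3)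
  proof (induction j' rule: dec_induct)
    case (step k)
    then show ?case
      using assms(1)[of "((i', k), (i', Suc k))"] assms(4) by (auto simp: grid_def)
  qed simp
  ultimately show ?thesis using assms(4,5) by auto
qed

section \<open>The bound on the Braess ratio\<close>

text \<open>The quadratic hypothesis says that \<open>\<beta>\<close> is at least
  \<open>e + e\<^sup>2 / F\<close>, so \<open>C\<close> is at least
  \<open>F + k * e\<^sup>2 / F + k * e\<close>. AM-GM on the first two terms bounds this below by
  \<open>e * (k + 2 * sqrt k)\<close>; the proof is this argument multiplied by
  \<open>F\<close>.\<close>

lemma ratio_bound:
  fixes F \<beta> e k C C' :: real
  assumes "0 \<le> F" "0 < e" "e\<^sup>2 \<le> F * (\<beta> - e)" "0 < k" "F + k * \<beta> \<le> C" "C' \<le> C + e"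
  shows "C' / C \<le> 1 + 1 / (k + 2 * sqrt k)"
proof -
  have "F \<noteq> 0"
  proof
    assume "F = 0"
    with assms(3) have "e\<^sup>2 \<le> 0" by simp
    with assms(2) show False by simp
  qed
  with assms(1) have F: "0 < F" by simp
  have "0 \<le> (F - sqrt k * e)\<^sup>2" by simp
  then have amgm: "2 * sqrt k * e * F \<le> F\<^sup>2 + k * e\<^sup>2"
    using assms(4) by (simp add: power2_diff power_mult_distrib algebra_simps)
  have "F * (e * (k + 2 * sqrt k)) \<le> F\<^sup>2 + k * (e\<^sup>2 + F * e)"
    using amgm by (simp add: algebra_simps)
  also have "\<dots> \<le> F\<^sup>2 + k * (F * \<beta>)"
    using assms(3,4) by (intro add_left_mono mult_left_mono) (simp_all add: algebra_simps)
  also have "\<dots> \<le> F * C"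
    using mult_left_mono[OF assms(5) assms(1)] by (simp add: power2_eq_square algebra_simps)
  finally have le: "e * (k + 2 * sqrt k) \<le> C" using F by simp
  have pos: "0 < k + 2 * sqrt k" using assms(4) by (simp add: add_pos_pos)
  then have C: "0 < C" using le assms(2) mult_pos_pos[of e "k + 2 * sqrt k"] by linarith
  have "C' / C \<le> (C + e) / C" using assms(6) C by (simp add: divide_right_mono)
  also have "\<dots> = 1 + e / C" using C by (simp add: field_simps)
  also have "e / C \<le> 1 / (k + 2 * sqrt k)" using le C pos by (simp add: field_simps)
  finally show ?thesis by simp
qed

theorem theorem4p1:
  fixes m n :: nat and q a b c d :: real and u v :: vertex and f g :: "edge \<Rightarrow> real"
  assumes "1 \<le> m" and "1 \<le> n" and "1 < max m n"
    and "0 < q" and "0 < a" and "0 \<le> b" and "0 \<le> c" and "0 \<le> d"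
    and "is_chord m n u v"
    and "user_equilibrium (grid m n) (0, 0) (m, n) q (grid_latency a b) f"
    and "user_equilibrium (grid_with_chord m n u v) (0, 0) (m, n) q (chord_latency a b c d u v) g"
  shows "braess_ratio m n a b c d u v f g
           \<le> 1 + 1 / (real (m + n) / (real (max m n) - 1)
                        + 2 * sqrt (real (m + n) / (real (max m n) - 1)))
       \<and> 1 + 1 / (real (m + n) / (real (max m n) - 1)
                        + 2 * sqrt (real (m + n) / (real (max m n) - 1))) < 4 / 3"
proof
  let ?G = "grid m n" and ?H = "grid_with_chord m n u v"
  let ?l = "chord_latency a b c d u v"
  let ?A = "arcs (grid m n)"
  \<comment> \<open>\<open>M\<close> bounds the levels climbed by any chord that raises the cost. As
    \<open>k\<close> exceeds 1, \<open>k + 2 * sqrt k\<close> exceeds 3, whence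
    \<open>4 / 3\<close>.\<close>
  define M where "M = real (max m n) - 1"
  define k where "k = real (m + n) / M"
  have M: "0 < M" using assms(3) by (simp add: M_def)
  have "M < real (m + n)" by (simp add: M_def)
  with M have k1: "1 < k" by (simp add: k_def)
  then have sk: "1 < sqrt k" by simp
  have "3 < k + 2 * sqrt k" using k1 sk by linarith
  then have "1 / (k + 2 * sqrt k) < 1 / 3" by (intro divide_strict_left_mono) auto
  then show "1 + 1 / (real (m + n) / (real (max m n) - 1)
      + 2 * sqrt (real (m + n) / (real (max m n) - 1))) < 4 / 3"
    by (simp add: k_def M_def)

  have st: "(0, 0) \<noteq> (m, n)" using assms(1) by simp
  have uv: "u \<in> verts ?G" "v \<in> verts ?G" "(u, v) \<notin> ?A"
    using assms(9) by (auto simp: is_chord_def)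
  have H: "verts ?H = verts ?G" "arcs ?H = insert (u, v) ?A" "tail ?H = fst" "head ?H = snd"
    using uv by (auto simp: grid_with_chord_def pre_digraph.add_arc_def grid_def)
  have Gth: "tail ?G = fst" "head ?G = snd" by (simp_all add: grid_def)
  have finH: "fin_digraph ?H"
  proof
    show "finite (arcs ?H)" using fin_digraph.finite_arcs[OF fin_digraph_grid] by (simp add: H)
    show "finite (verts ?H)" using fin_digraph.finite_verts[OF fin_digraph_grid] by (simp add: H)
  qed (use uv in \<open>auto simp: H grid_def\<close>)
  have finA: "finite ?A" by (rule fin_digraph.finite_arcs[OF fin_digraph_grid])
  note F = user_equilibrium_facts[OF fin_digraph_grid assms(10) st, unfolded Gth]
  note K = user_equilibrium_facts[OF finH assms(11) st, unfolded H(3,4)]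

  define x where "x = g (u, v)"
  have x: "0 \<le> x" "x \<le> q" using K(3,4)[of "(u, v)"] by (auto simp: x_def H)
  have gradf: "(\<Sum>e\<in>?A. f e * (\<chi> (snd e) - \<chi> (fst e))) = q * (\<chi> (m, n) - \<chi> (0, 0))" for \<chi>
    by (rule F(1))
  \<comment> \<open>With the chord term on the right, this describes \<open>g\<close> on the grid
    arcs alone, where it need not be conserved at \<open>u\<close> and \<open>v\<close>.\<close>
  have gradg: "(\<Sum>e\<in>?A. g e * (\<chi> (snd e) - \<chi> (fst e)))
      = q * (\<chi> (m, n) - \<chi> (0, 0)) - x * (\<chi> v - \<chi> u)" for \<chi>
    using K(1)[of \<chi>] uv(3) finA by (simp add: H x_def)

  define lev :: "vertex \<Rightarrow> real" where "lev w = real (fst w + snd w)" for w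
  define L where "L = lev v - lev u"
  have lev1: "lev (snd e) - lev (fst e) = 1" if "e \<in> ?A" for e
    using that by (cases e rule: grid_arc_cases) (auto simp: lev_def)
  have sumf: "(\<Sum>e\<in>?A. f e) = q * real (m + n)"
    using gradf[of lev] lev1 by (simp add: lev_def)
  have sumg: "(\<Sum>e\<in>?A. g e) = q * real (m + n) - x * L"
    using gradg[of lev] lev1 by (simp add: lev_def L_def)

  define Sff Sfg Sgg where "Sff = (\<Sum>e\<in>?A. (f e)\<^sup>2)" and "Sfg = (\<Sum>e\<in>?A. f e * g e)"
    and "Sgg = (\<Sum>e\<in>?A. (g e)\<^sup>2)"
  define Cold where "Cold = flow_cost ?G (grid_latency a b) f"
  define Cnew where "Cnew = flow_cost ?H ?l g"
  have Cold: "Cold = a * Sff + b * (q * real (m + n))"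
    unfolding Cold_def flow_cost_def Sff_def sumf[symmetric] sum_distrib_left sum.distrib[symmetric]
    by (intro sum.cong refl) (simp add: grid_latency_def power2_eq_square algebra_simps)
  have lg: "?l e (g e) = a * g e + b" if "e \<in> ?A" for e
    using that uv(3) by (auto simp: chord_latency_def grid_latency_def)
  have "(\<Sum>e\<in>?A. g e * ?l e (g e)) = a * Sgg + b * (q * real (m + n) - x * L)"
    unfolding Sgg_def sumg[symmetric] sum_distrib_left sum.distrib[symmetric]
    by (intro sum.cong refl) (simp add: lg power2_eq_square algebra_simps)
  then have Cnew: "Cnew = x * (c * x + d) + (a * Sgg + b * (q * real (m + n) - x * L))"
    using uv(3) finA
    by (simp add: Cnew_def flow_cost_def H) (simp add: x_def chord_latency_def)

  \<comment> \<open>The old flow is tested under the latencies at \<open>g\<close>. Since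
    \<open>f\<close> lives on grid arcs, distances along grid paths suffice, and these paths bound
    the equilibrium cost of \<open>g\<close>.\<close>
  define w where "w e = ?l e (g e)" for e
  obtain p where p: "p \<in> st_paths ?H (0, 0) (m, n)" "(\<Sum>e\<leftarrow>p. w e) = grid_dist w (m, n)"
    using grid_dist_path[of ?H m n m n w] finH
    by (auto simp: st_paths_def fin_digraph_def H)
  have "Cnew \<le> q * grid_dist w (m, n)"
    using K(2)[OF p(1)] p(2) by (simp add: Cnew_def path_latency_def w_def)
  also have "\<dots> = (\<Sum>e\<in>?A. f e * (grid_dist w (snd e) - grid_dist w (fst e)))"
    by (simp add: gradf)
  also have "\<dots> \<le> (\<Sum>e\<in>?A. f e * w e)"
  proof (intro sum_mono mult_left_mono)
    show "grid_dist w (snd e) - grid_dist w (fst e) \<le> w e" if "e \<in> ?A" for e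
      using grid_dist_le[OF that, of w] by (simp add: Gth)
  qed (rule F(4))
  also have "\<dots> = a * Sfg + b * (q * real (m + n))"
    unfolding Sfg_def sumf[symmetric] sum_distrib_left sum.distrib[symmetric]
    by (intro sum.cong refl) (simp add: w_def lg algebra_simps)
  finally have vi: "Cnew \<le> a * Sfg + b * (q * real (m + n))" .

  define \<epsilon> where "\<epsilon> = a * (Sfg - Sff)"
  have excess: "Cnew \<le> Cold + \<epsilon>" using vi by (simp add: Cold \<epsilon>_def algebra_simps)
  have C0: "0 \<le> Cold" using assms(4-6) by (simp add: Cold Sff_def sum_nonneg)
  have "Cnew / Cold \<le> 1 + 1 / (k + 2 * sqrt k)"
  proof (cases "\<epsilon> \<le> 0")
    case True
    with excess C0 have "Cnew / Cold \<le> 1" by (cases "Cold = 0") (auto simp: divide_le_eq_1)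
    moreover have "0 \<le> 1 / (k + 2 * sqrt k)" using k1 sk by simp
    ultimately show ?thesis by linarith
  next
    case False
    have "\<not> (fst u \<le> fst v \<and> snd u \<le> snd v)"
    proof
      assume le: "fst u \<le> fst v \<and> snd u \<le> snd v"
      obtain \<psi> where \<psi>: "\<And>e. e \<in> ?A \<Longrightarrow> a * f e = \<psi> (head ?G e) - \<psi> (tail ?G e)"
        using grid_equilibrium_potential[OF _ assms(5,4,10)] assms(1) by auto
      have mono: "\<psi> (tail ?G e) \<le> \<psi> (head ?G e)" if "e \<in> ?A" for e
        using \<psi>[OF that] mult_nonneg_nonneg[OF less_imp_le[OF assms(5)] F(4)[OF that]] by simp
      have "\<psi> u \<le> \<psi> v"
        using grid_potential_mono[of m n \<psi> "fst u" "fst v" "snd u" "snd v", OF mono] le uv(1,2)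
        by (auto simp: grid_def)
      have "a * Sff = (\<Sum>e\<in>?A. f e * (\<psi> (snd e) - \<psi> (fst e)))"
        unfolding Sff_def sum_distrib_left
        by (intro sum.cong refl) (simp add: \<psi>[unfolded Gth, symmetric] power2_eq_square)
      moreover have "a * Sfg = (\<Sum>e\<in>?A. g e * (\<psi> (snd e) - \<psi> (fst e)))"
        unfolding Sfg_def sum_distrib_left
        by (intro sum.cong refl) (simp add: \<psi>[unfolded Gth, symmetric])
      ultimately have "\<epsilon> = - (x * (\<psi> v - \<psi> u))"
        unfolding \<epsilon>_def gradf gradg by (simp add: right_diff_distrib)
      with False x(1) \<open>\<psi> u \<le> \<psi> v\<close> show False by simp
    qed
    \<comment> \<open>One coordinate drops by at least 1 and the other rises by at most
      \<open>max m n\<close>.\<close>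
    then have LM: "L \<le> M"
      using uv(1,2) by (cases u; cases v) (auto simp: L_def M_def lev_def grid_def)
    define \<beta> where "\<beta> = b * (M * q)"
    have "x * L \<le> x * M" using LM x by (intro mult_left_mono)
    also have "\<dots> \<le> q * M" using x M by (intro mult_right_mono) auto
    finally have "b * (x * L) \<le> \<beta>" unfolding \<beta>_def using assms(6)
      by (intro mult_left_mono) (simp_all add: mult.commute)
    moreover have "0 \<le> x * (c * x + d)" using x assms(7,8) by simp
    \<comment> \<open>The left side is \<open>a\<close> times the squared norm of
      \<open>g - f\<close>; the chord's own cost is nonnegative and is dropped.\<close>
    ultimately have d2: "a * (Sgg - 2 * Sfg + Sff) \<le> \<beta> - \<epsilon>"
      using vi by (simp add: Cnew \<epsilon>_def algebra_simps)
    \<comment> \<open>Adding \<open>Sff\<^sup>2 - 2 * Sff * Sfg\<close> to both sides turns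
      Cauchy-Schwarz for \<open>f\<close> and \<open>g\<close> into that for \<open>f\<close> and
      \<open>g - f\<close>.\<close>
    have "Sfg\<^sup>2 \<le> Sff * Sgg"
      unfolding Sff_def Sfg_def Sgg_def by (rule Cauchy_Schwarz_ineq_sum)
    then have "(Sfg - Sff)\<^sup>2 \<le> Sff * (Sgg - 2 * Sfg + Sff)"
      by (simp add: power2_eq_square algebra_simps)
    then have "a\<^sup>2 * (Sfg - Sff)\<^sup>2 \<le> a\<^sup>2 * (Sff * (Sgg - 2 * Sfg + Sff))"
      by (rule mult_left_mono) simp
    then have "\<epsilon>\<^sup>2 \<le> (a * Sff) * (a * (Sgg - 2 * Sfg + Sff))"
      by (simp add: \<epsilon>_def power_mult_distrib power2_eq_square mult_ac)
    also have "\<dots> \<le> (a * Sff) * (\<beta> - \<epsilon>)"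
      using d2 assms(5) by (intro mult_left_mono) (simp_all add: Sff_def sum_nonneg)
    finally have e2: "\<epsilon>\<^sup>2 \<le> (a * Sff) * (\<beta> - \<epsilon>)" .
    \<comment> \<open>The value of \<open>k\<close> makes \<open>k * \<beta>\<close> exactly the
      constant-latency part of \<open>Cold\<close>.\<close>
    have "k * \<beta> = b * (q * real (m + n))" using M by (simp add: k_def \<beta>_def)
    then have "a * Sff + k * \<beta> \<le> Cold" by (simp add: Cold)
    then show ?thesis
      using False assms(5) k1 by (intro ratio_bound[OF _ _ e2 _ _ excess])
        (simp_all add: Sff_def sum_nonneg)
  qed
  then show "braess_ratio m n a b c d u v f g
           \<le> 1 + 1 / (real (m + n) / (real (max m n) - 1)
                        + 2 * sqrt (real (m + n) / (real (max m n) - 1)))"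
    by (simp add: braess_ratio_def Cnew_def Cold_def k_def M_def)
qed

end
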